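(* Let $n\ge 3$. The maximum size (number of edges) of an almost peripheral graph of order $n$ is $\lfloor (n-1)^2/2\rfloor$. If $n$ is odd, this maximum is attained uniquely (up to isomorphism) by the complement of the disjoint union $K_1 + \frac{n-1}{2}K_2$ (i.e. a vertex joined to all vertices of $K_{n-1}$ minus a perfect matching); if $n$ is even, it is attained uniquely by the complement of the disjoint union $K_1+\frac{n-4}{2}K_2+P_3$.
   Context: All graphs are finite and simple. For a connected graph $G$, the eccentricity of a vertex $v$ is $\max_{u\in V(G)} d(v,u)$; the diameter is the maximum eccentricity. A peripheral vertex is one whose eccentricity equals the diameter. A connected graph of order $n$ is almost peripheral if it has exactly $n-1$ peripheral vertices. For graphs $G,H$, $G+H$ denotes their disjoint union, $tK_2$ denotes the disjoint union of $t$ copies of $K_2$, $P_3$ is the path on $3$ vertices, and $\overline{G}$ is the complement of $G$. *)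

theory Defs
  imports Main
begin

record 'a ugraph =
  verts :: "'a set"
  edges :: "'a set set"

definition simple_graph :: "'a ugraph \<Rightarrow> bool" where
  "simple_graph G \<longleftrightarrow> finite (verts G) \<and> (\<forall>e\<in>edges G. e \<subseteq> verts G \<and> card e = 2)"

definition graph_order :: "'a ugraph \<Rightarrow> nat" where
  "graph_order G = card (verts G)"

definition graph_size :: "'a ugraph \<Rightarrow> nat" where
  "graph_size G = card (edges G)"

text \<open>A path is given by its list of vertices; its length is the number of its edges, i.e. one less
  than the length of the list.\<close>

definition path_between :: "'a ugraph \<Rightarrow> 'a \<Rightarrow> 'a list \<Rightarrow> 'a \<Rightarrow> bool" where
  "path_between G u p v \<longleftrightarrow>
     p \<noteq> [] \<and> hd p = u \<and> last p = v \<and> set p \<subseteq> verts G \<and> distinct p \<and>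
     successively (\<lambda>x y. {x, y} \<in> edges G) p"

definition connected_graph :: "'a ugraph \<Rightarrow> bool" where
  "connected_graph G \<longleftrightarrow>
     simple_graph G \<and> verts G \<noteq> {} \<and> (\<forall>u\<in>verts G. \<forall>v\<in>verts G. \<exists>p. path_between G u p v)"

text \<open>The notions from here to peripheral vertices are only meaningful for connected graphs.\<close>

definition graph_dist :: "'a ugraph \<Rightarrow> 'a \<Rightarrow> 'a \<Rightarrow> nat" where
  "graph_dist G u v = (LEAST k. \<exists>p. path_between G u p v \<and> length p = Suc k)"

definition eccentricity :: "'a ugraph \<Rightarrow> 'a \<Rightarrow> nat" where
  "eccentricity G v = Max ((\<lambda>u. graph_dist G v u) ` verts G)"

definition graph_diameter :: "'a ugraph \<Rightarrow> nat" where
  "graph_diameter G = Max (eccentricity G ` verts G)"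

definition peripheral :: "'a ugraph \<Rightarrow> 'a \<Rightarrow> bool" where
  "peripheral G v \<longleftrightarrow> v \<in> verts G \<and> eccentricity G v = graph_diameter G"

definition almost_peripheral :: "'a ugraph \<Rightarrow> bool" where
  "almost_peripheral G \<longleftrightarrow>
     connected_graph G \<and> card {v. peripheral G v} = graph_order G - 1"

text \<open>Isomorphism is meant for simple graphs, for which the case of equal vertices is vacuous.\<close>

definition graph_iso :: "'a ugraph \<Rightarrow> 'b ugraph \<Rightarrow> bool" where
  "graph_iso G H \<longleftrightarrow>
     (\<exists>f. bij_betw f (verts G) (verts H) \<and>
          (\<forall>u\<in>verts G. \<forall>v\<in>verts G. {u, v} \<in> edges G \<longleftrightarrow> {f u, f v} \<in> edges H))"

definition complement :: "'a ugraph \<Rightarrow> 'a ugraph" where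
  "complement G = \<lparr>verts = verts G, edges = {e. e \<subseteq> verts G \<and> card e = 2 \<and> e \<notin> edges G}\<rparr>"

definition complete_graph :: "nat \<Rightarrow> nat ugraph" where
  "complete_graph k = \<lparr>verts = {..<k}, edges = {e. e \<subseteq> {..<k} \<and> card e = 2}\<rparr>"

definition path_graph :: "nat \<Rightarrow> nat ugraph" where
  "path_graph k = \<lparr>verts = {..<k}, edges = {{i, Suc i} | i. Suc i < k}\<rparr>"

definition disjoint_union :: "'a ugraph \<Rightarrow> 'b ugraph \<Rightarrow> ('a + 'b) ugraph" where
  "disjoint_union G H =
     \<lparr>verts = verts G <+> verts H,
      edges = (\<lambda>e. Inl ` e) ` edges G \<union> (\<lambda>e. Inr ` e) ` edges H\<rparr>"

definition copies :: "nat \<Rightarrow> 'a ugraph \<Rightarrow> (nat \<times> 'a) ugraph" where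
  "copies t G =
     \<lparr>verts = {..<t} \<times> verts G, edges = {Pair i ` e | i e. i < t \<and> e \<in> edges G}\<rparr>"

definition graph_join :: "'a ugraph \<Rightarrow> 'b ugraph \<Rightarrow> ('a + 'b) ugraph" where
  "graph_join G H =
     \<lparr>verts = verts G <+> verts H,
      edges = edges (disjoint_union G H) \<union> {{Inl u, Inr v} | u v. u \<in> verts G \<and> v \<in> verts H}\<rparr>"

definition delete_edges :: "'a ugraph \<Rightarrow> 'a set set \<Rightarrow> 'a ugraph" where
  "delete_edges G M = \<lparr>verts = verts G, edges = edges G - M\<rparr>"

definition perfect_matching :: "'a ugraph \<Rightarrow> 'a set set \<Rightarrow> bool" where
  "perfect_matching G M \<longleftrightarrow> M \<subseteq> edges G \<and> (\<forall>v\<in>verts G. \<exists>!e. e \<in> M \<and> v \<in> e)"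

definition extremal_odd :: "nat \<Rightarrow> (nat + nat \<times> nat) ugraph" where
  "extremal_odd n =
     complement (disjoint_union (complete_graph 1) (copies ((n - 1) div 2) (complete_graph 2)))"

definition extremal_even :: "nat \<Rightarrow> ((nat + nat \<times> nat) + nat) ugraph" where
  "extremal_even n =
     complement
       (disjoint_union
         (disjoint_union (complete_graph 1) (copies ((n - 4) div 2) (complete_graph 2)))
         (path_graph 3))"

end

theory Submission
  imports Defs "HOL-Library.Countable"
begin

text \<open>
  Let \<open>c\<close> be the only non-peripheral vertex. Its eccentricity is at least 1, so every other vertex
  has eccentricity at least 2, hence a neighbour in the complement. The degrees in the complement
  therefore add up to at least \<open>n - 1\<close>, which is the bound. For odd \<open>n\<close> equality makes the
  complement a perfect matching away from \<open>c\<close>. For even \<open>n\<close> the degrees in the complement add up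
  to \<open>n\<close>. If \<open>c\<close> is not isolated there, the diameter is at least 3, and two vertices at distance at
  least 3 have complement degrees with sum at least \<open>n\<close>, which is too much. So \<open>c\<close> is isolated and
  exactly one vertex has degree 2 in the complement; it is the middle of the \<open>P\<^sub>3\<close>.
\<close>

subsection \<open>Neighbourhoods and degree sums\<close>

definition nbrs :: "'a ugraph \<Rightarrow> 'a \<Rightarrow> 'a set" where
  "nbrs G v = {u. {v, u} \<in> edges G}"

definition induced :: "'a ugraph \<Rightarrow> 'a set \<Rightarrow> 'a ugraph" where
  "induced G A = \<lparr>verts = A, edges = {e \<in> edges G. e \<subseteq> A}\<rparr>"

lemma nbrs_sym: "u \<in> nbrs G v \<longleftrightarrow> v \<in> nbrs G u"
  by (simp add: nbrs_def insert_commute)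

lemma simple_graph_edgeD:
  assumes "simple_graph G" "{u, v} \<in> edges G"
  shows "u \<in> verts G" "v \<in> verts G" "u \<noteq> v"
  using assms by (auto simp: simple_graph_def)

lemma simple_graph_finite:
  assumes "simple_graph G"
  shows "finite (verts G)" "finite (edges G)"
proof -
  show "finite (verts G)" using assms by (simp add: simple_graph_def)
  moreover have "edges G \<subseteq> Pow (verts G)" using assms by (auto simp: simple_graph_def)
  ultimately show "finite (edges G)" by (meson finite_Pow_iff finite_subset)
qed

lemma nbrs_subset: "simple_graph G \<Longrightarrow> nbrs G v \<subseteq> verts G - {v}"
  by (auto simp: nbrs_def dest: simple_graph_edgeD)

lemma finite_nbrs: "simple_graph G \<Longrightarrow> finite (nbrs G v)"
  by (meson finite_Diff finite_subset nbrs_subset simple_graph_finite(1))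

lemma simple_graph_edgeE:
  assumes "simple_graph G" "e \<in> edges G" "v \<in> e"
  obtains u where "e = {v, u}" "u \<noteq> v"
proof -
  have "card e = 2" using assms by (auto simp: simple_graph_def)
  then obtain x y where "e = {x, y}" "x \<noteq> y" by (auto simp: card_2_iff)
  with assms(3) that show ?thesis by (metis insertE insert_commute singletonD)
qed

text \<open>Sending \<open>u\<close> to \<open>{v, u}\<close> is a bijection from the neighbours of
  \<open>v\<close> onto the edges at \<open>v\<close>, because every edge has two elements. This
  links degrees to edges, both for the double counting in \<open>handshake\<close> and for finding
  the unique edge at a vertex of degree 1.\<close>

lemma card_incident_edges:
  assumes "simple_graph G"
  shows "card {e \<in> edges G. v \<in> e} = card (nbrs G v)"
proof -
  have "bij_betw (\<lambda>u. {v, u}) (nbrs G v) {e \<in> edges G. v \<in> e}"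
    unfolding bij_betw_def
  proof
    show "inj_on (\<lambda>u. {v, u}) (nbrs G v)"
      by (auto simp: inj_on_def doubleton_eq_iff)
    show "(\<lambda>u. {v, u}) ` nbrs G v = {e \<in> edges G. v \<in> e}"
      by (auto simp: nbrs_def image_iff) (metis simple_graph_edgeE[OF assms])
  qed
  then show ?thesis by (simp add: bij_betw_same_card)
qed

text \<open>Incident pairs of a vertex and an edge are counted in two ways: by vertices they give
  the degrees, by edges they give 2 each.\<close>

lemma handshake:
  assumes "simple_graph G"
  shows "(\<Sum>v\<in>verts G. card (nbrs G v)) = 2 * graph_size G"
proof -
  note fin = simple_graph_finite[OF assms]
  have "(\<Sum>v\<in>verts G. card (nbrs G v)) = (\<Sum>v\<in>verts G. \<Sum>e\<in>edges G. if v \<in> e then 1 else 0)"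
    by (simp flip: card_incident_edges[OF assms] add: fin Int_def flip: sum.inter_filter)
  also have "\<dots> = (\<Sum>e\<in>edges G. \<Sum>v\<in>verts G. if v \<in> e then 1 else 0)"
    by (rule sum.swap)
  also have "\<dots> = (\<Sum>e\<in>edges G. 2)"
  proof (rule sum.cong[OF refl])
    fix e assume "e \<in> edges G"
    then have "{v \<in> verts G. v \<in> e} = e" "card e = 2"
      using assms by (auto simp: simple_graph_def)
    then show "(\<Sum>v\<in>verts G. if v \<in> e then 1 else 0) = (2::nat)"
      by (simp add: fin flip: sum.inter_filter)
  qed
  finally show ?thesis by (simp add: graph_size_def)
qed

subsection \<open>Graph constructions\<close>

lemma verts_complement [simp]: "verts (complement G) = verts G"
  by (simp add: complement_def)

lemma edge_complement:
  "{u, v} \<in> edges (complement G) \<longleftrightarrow>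
     u \<in> verts G \<and> v \<in> verts G \<and> u \<noteq> v \<and> {u, v} \<notin> edges G"
  by (auto simp: complement_def card_2_iff doubleton_eq_iff)

lemma simple_graph_complement: "finite (verts G) \<Longrightarrow> simple_graph (complement G)"
  by (auto simp: complement_def simple_graph_def)

lemma complement_complement: "simple_graph G \<Longrightarrow> complement (complement G) = G"
  by (cases G) (auto simp: complement_def simple_graph_def)

text \<open>The edges of \<open>G\<close> and of its complement partition the two-element subsets of
  the vertex set. An upper bound on the size of \<open>G\<close> thus becomes a lower bound for the
  complement.\<close>

lemma graph_size_complement:
  assumes "simple_graph G"
  shows "graph_size G + graph_size (complement G) = graph_order G choose 2"
proof -
  note fin = simple_graph_finite[OF assms]
  have "{e. e \<subseteq> verts G \<and> card e = 2} = edges G \<union> edges (complement G)"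
    using assms by (auto simp: complement_def simple_graph_def)
  moreover have "edges G \<inter> edges (complement G) = {}"
    by (auto simp: complement_def)
  ultimately have "card {e. e \<subseteq> verts G \<and> card e = 2} = card (edges G) + card (edges (complement G))"
    using fin simple_graph_finite[OF simple_graph_complement[OF fin(1)]]
    by (simp add: card_Un_disjoint)
  then show ?thesis
    using n_subsets[OF fin(1), of 2] by (simp add: graph_size_def graph_order_def)
qed

section \<open>Complete graphs and the path on three vertices\<close>

lemma verts_complete_graph [simp]: "verts (complete_graph k) = {..<k}"
  by (simp add: complete_graph_def)

lemma edge_complete_graph: "{u, v} \<in> edges (complete_graph k) \<longleftrightarrow> u < k \<and> v < k \<and> u \<noteq> v"
  by (auto simp: complete_graph_def card_2_iff doubleton_eq_iff)

lemma simple_complete_graph: "simple_graph (complete_graph k)"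
  by (auto simp: complete_graph_def simple_graph_def)

lemma order_complete_graph [simp]: "graph_order (complete_graph k) = k"
  by (simp add: graph_order_def)

lemma size_complete_graph: "graph_size (complete_graph k) = k choose 2"
  using n_subsets[of "{..<k}" 2] by (simp add: graph_size_def complete_graph_def)

lemma edges_path_graph_3: "edges (path_graph 3) = {{0, 1}, {1, 2}}"
proof -
  have "Suc i < 3 \<longleftrightarrow> i = 0 \<or> i = 1" for i by auto
  then show ?thesis by (auto simp: path_graph_def numeral_2_eq_2)
qed

lemma verts_path_graph [simp]: "verts (path_graph k) = {..<k}"
  by (simp add: path_graph_def)

lemma simple_path_graph: "simple_graph (path_graph k)"
  by (auto simp: path_graph_def simple_graph_def)

lemma size_path_graph_3: "graph_size (path_graph 3) = 2"
  by (simp add: graph_size_def edges_path_graph_3 doubleton_eq_iff)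

section \<open>Disjoint unions\<close>

lemma verts_disjoint_union [simp]: "verts (disjoint_union G H) = verts G <+> verts H"
  by (simp add: disjoint_union_def)

lemma inj_image_Inl: "inj (\<lambda>e. Inl ` e)" and inj_image_Inr: "inj (\<lambda>e. Inr ` e)"
  by (auto intro!: injI simp: inj_image_eq_iff)

lemma edge_disjoint_union [simp]:
  "{Inl u, Inl v} \<in> edges (disjoint_union G H) \<longleftrightarrow> {u, v} \<in> edges G"
  "{Inr x, Inr y} \<in> edges (disjoint_union G H) \<longleftrightarrow> {x, y} \<in> edges H"
  "{Inl u, Inr y} \<notin> edges (disjoint_union G H)"
  "{Inr y, Inl u} \<notin> edges (disjoint_union G H)"
proof -
  have "{Inl u, Inl v} \<in> (\<lambda>e. Inl ` e) ` edges G \<longleftrightarrow> {u, v} \<in> edges G"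
    using inj_image_mem_iff[OF inj_image_Inl, of "{u, v}" "edges G"] by simp
  moreover have "{Inl u, Inl v} \<notin> (\<lambda>e. Inr ` e) ` edges H"
    by (auto simp: set_eq_iff)
  ultimately show "{Inl u, Inl v} \<in> edges (disjoint_union G H) \<longleftrightarrow> {u, v} \<in> edges G"
    by (simp add: disjoint_union_def)
  have "{Inr x, Inr y} \<in> (\<lambda>e. Inr ` e) ` edges H \<longleftrightarrow> {x, y} \<in> edges H"
    using inj_image_mem_iff[OF inj_image_Inr, of "{x, y}" "edges H"] by simp
  moreover have "{Inr x, Inr y} \<notin> (\<lambda>e. Inl ` e) ` edges G"
    by (auto simp: set_eq_iff)
  ultimately show "{Inr x, Inr y} \<in> edges (disjoint_union G H) \<longleftrightarrow> {x, y} \<in> edges H"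
    by (simp add: disjoint_union_def)
  show "{Inl u, Inr y} \<notin> edges (disjoint_union G H)"
    "{Inr y, Inl u} \<notin> edges (disjoint_union G H)"
    unfolding disjoint_union_def by (auto simp: set_eq_iff)
qed

lemma simple_disjoint_union:
  "simple_graph G \<Longrightarrow> simple_graph H \<Longrightarrow> simple_graph (disjoint_union G H)"
  unfolding simple_graph_def
  by (intro conjI; simp add: disjoint_union_def card_image ball_Un subset_iff; blast)

lemma order_disjoint_union:
  "simple_graph G \<Longrightarrow> simple_graph H \<Longrightarrow>
    graph_order (disjoint_union G H) = graph_order G + graph_order H"
  by (simp add: graph_order_def card_Plus simple_graph_finite)

lemma size_disjoint_union:
  assumes "simple_graph G" "simple_graph H"
  shows "graph_size (disjoint_union G H) = graph_size G + graph_size H"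
proof -
  \<comment> \<open>The images of the empty set under \<open>Inl\<close> and \<open>Inr\<close>
    coincide, so the two edge sets are disjoint only once an empty edge is excluded.\<close>
  have "{} \<notin> edges G" using assms(1) by (auto simp: simple_graph_def)
  then have "(\<lambda>e. Inl ` e) ` edges G \<inter> (\<lambda>e. Inr ` e) ` edges H = {}"
    by (auto simp: set_eq_iff image_iff) (metis Inl_Inr_False all_not_in_conv)
  then show ?thesis
    using assms
    by (simp add: graph_size_def disjoint_union_def card_Un_disjoint simple_graph_finite
        card_image inj_on_subset[OF inj_image_Inl] inj_on_subset[OF inj_image_Inr])
qed

section \<open>Disjoint copies of one graph\<close>

lemma verts_copies [simp]: "verts (copies t G) = {..<t} \<times> verts G"
  by (simp add: copies_def)

lemma edge_copies:
  "{x, y} \<in> edges (copies t G) \<longleftrightarrow> fst x = fst y \<and> fst x < t \<and> {snd x, snd y} \<in> edges G"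
proof
  assume "{x, y} \<in> edges (copies t G)"
  then obtain i e where ie: "{x, y} = Pair i ` e" "i < t" "e \<in> edges G"
    by (auto simp: copies_def)
  have "snd ` {x, y} = e" unfolding ie(1) by (simp add: image_image)
  moreover have "x \<in> Pair i ` e" "y \<in> Pair i ` e" using ie(1) by auto
  ultimately show "fst x = fst y \<and> fst x < t \<and> {snd x, snd y} \<in> edges G"
    using ie(2,3) by auto
next
  assume a: "fst x = fst y \<and> fst x < t \<and> {snd x, snd y} \<in> edges G"
  then have "{x, y} = Pair (fst x) ` {snd x, snd y}" by (auto simp: prod_eq_iff)
  with a show "{x, y} \<in> edges (copies t G)" unfolding copies_def ugraph.simps by blast
qed

lemma simple_copies: "simple_graph G \<Longrightarrow> simple_graph (copies t G)"
  unfolding simple_graph_def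
  by (intro conjI ballI, simp) (auto simp: copies_def card_image inj_on_def)

lemma order_copies: "graph_order (copies t G) = t * graph_order G"
  by (simp add: graph_order_def card_cartesian_product)

lemma size_copies:
  assumes "simple_graph G"
  shows "graph_size (copies t G) = t * graph_size G"
proof -
  have "inj_on (\<lambda>(i, e). Pair i ` e) ({..<t} \<times> edges G)"
  proof (rule inj_onI, clarify)
    fix i e j e'
    assume e: "e \<in> edges G" and eq: "Pair i ` e = Pair j ` e'"
    \<comment> \<open>A nonempty edge reveals the index of its copy; projecting with
      \<open>snd\<close> then recovers the edge itself.\<close>
    have "e \<noteq> {}" using assms e by (auto simp: simple_graph_def)
    then have "i = j" using eq by auto
    moreover have "snd ` Pair i ` e = snd ` Pair j ` e'" using eq by simp
    ultimately show "i = j \<and> e = e'" by (simp add: image_image)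
  qed
  moreover have "edges (copies t G) = (\<lambda>(i, e). Pair i ` e) ` ({..<t} \<times> edges G)"
    by (auto simp: copies_def image_iff)
  ultimately show ?thesis by (simp add: graph_size_def card_image card_cartesian_product)
qed

section \<open>Induced subgraphs\<close>

lemma verts_induced [simp]: "verts (induced G A) = A"
  by (simp add: induced_def)

lemma edge_induced: "{u, v} \<in> edges (induced G A) \<longleftrightarrow> {u, v} \<in> edges G \<and> u \<in> A \<and> v \<in> A"
  by (auto simp: induced_def)

lemma simple_induced: "simple_graph G \<Longrightarrow> A \<subseteq> verts G \<Longrightarrow> simple_graph (induced G A)"
  by (auto simp: induced_def simple_graph_def intro: finite_subset)

lemma induced_induced: "B \<subseteq> A \<Longrightarrow> induced (induced G A) B = induced G B"
  by (auto simp: induced_def)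

subsection \<open>Isomorphisms\<close>

text \<open>A bijection preserves distinctness as well as non-adjacency, and these are all that
  complement edges depend on. Uniqueness can therefore be argued entirely in the complement.\<close>

lemma graph_iso_complement:
  assumes "graph_iso G H"
  shows "graph_iso (complement G) (complement H)"
proof -
  obtain f where f: "bij_betw f (verts G) (verts H)"
    and e: "\<forall>u\<in>verts G. \<forall>v\<in>verts G. {u, v} \<in> edges G \<longleftrightarrow> {f u, f v} \<in> edges H"
    using assms by (auto simp: graph_iso_def)
  have "{u, v} \<in> edges (complement G) \<longleftrightarrow> {f u, f v} \<in> edges (complement H)"
    if "u \<in> verts G" "v \<in> verts G" for u v
    using that e bij_betwE[OF f] bij_betw_imp_inj_on[OF f]
    by (simp add: edge_complement inj_on_eq_iff)
  with f show ?thesis unfolding graph_iso_def verts_complement by blast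
qed

text \<open>Isomorphisms on the two sides are glued with \<open>Inl\<close> and \<open>Inr\<close>;
  pairs across match because neither graph has an edge there. This allows a complement graph to be
  identified one piece at a time.\<close>

lemma graph_iso_disjoint_union:
  assumes V: "verts H = A \<union> B" "A \<inter> B = {}"
    and noedge: "\<And>a b. a \<in> A \<Longrightarrow> b \<in> B \<Longrightarrow> {a, b} \<notin> edges H"
    and isoA: "graph_iso (induced H A) X" and isoB: "graph_iso (induced H B) Y"
  shows "graph_iso H (disjoint_union X Y)"
proof -
  obtain f where f: "bij_betw f A (verts X)"
    and fe: "\<And>u v. u \<in> A \<Longrightarrow> v \<in> A \<Longrightarrow> {u, v} \<in> edges H \<longleftrightarrow> {f u, f v} \<in> edges X"
    using isoA by (auto simp: graph_iso_def edge_induced)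
  obtain g where g: "bij_betw g B (verts Y)"
    and ge: "\<And>u v. u \<in> B \<Longrightarrow> v \<in> B \<Longrightarrow> {u, v} \<in> edges H \<longleftrightarrow> {g u, g v} \<in> edges Y"
    using isoB by (auto simp: graph_iso_def edge_induced)
  define h where "h v = (if v \<in> A then Inl (f v) else Inr (g v))" for v
  have hA: "h v = Inl (f v)" if "v \<in> A" for v using that by (simp add: h_def)
  have hB: "h v = Inr (g v)" if "v \<in> B" for v using that V(2) by (auto simp: h_def)
  have noedge': "{b, a} \<notin> edges H" if "a \<in> A" "b \<in> B" for a b
    using noedge[OF that] by (simp add: insert_commute)
  have "bij_betw (Inl \<circ> f) A (Inl ` verts X)"
    by (rule bij_betw_trans[OF f]) (simp add: inj_on_imp_bij_betw)
  then have "bij_betw h A (Inl ` verts X)"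
    by (rule bij_betw_cong[THEN iffD1, rotated]) (simp add: hA)
  moreover have "bij_betw (Inr \<circ> g) B (Inr ` verts Y)"
    by (rule bij_betw_trans[OF g]) (simp add: inj_on_imp_bij_betw)
  then have "bij_betw h B (Inr ` verts Y)"
    by (rule bij_betw_cong[THEN iffD1, rotated]) (simp add: hB)
  ultimately have "bij_betw h (verts H) (verts (disjoint_union X Y))"
    unfolding V(1) verts_disjoint_union Plus_def by (rule bij_betw_combine) auto
  moreover have "{u, v} \<in> edges H \<longleftrightarrow> {h u, h v} \<in> edges (disjoint_union X Y)"
    if uv: "u \<in> verts H" "v \<in> verts H" for u v
  proof -
    consider "u \<in> A" "v \<in> A" | "u \<in> A" "v \<in> B" | "u \<in> B" "v \<in> A" | "u \<in> B" "v \<in> B"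
      using uv unfolding V(1) by blast
    then show ?thesis
    proof cases
      case 1 then show ?thesis by (simp add: hA fe)
    next
      case 2 then show ?thesis by (simp add: hA hB noedge)
    next
      case 3 then show ?thesis by (simp add: hA hB noedge')
    next
      case 4 then show ?thesis by (simp add: hB ge)
    qed
  qed
  ultimately show ?thesis unfolding graph_iso_def by blast
qed

lemma graph_iso_K1:
  assumes "simple_graph H" "c \<in> verts H"
  shows "graph_iso (induced H {c}) (complete_graph 1)"
  unfolding graph_iso_def
proof (intro exI conjI ballI)
  show "bij_betw (\<lambda>_. 0) (verts (induced H {c})) (verts (complete_graph 1))"
    by (auto simp: bij_betw_def)
  fix u v assume "u \<in> verts (induced H {c})" "v \<in> verts (induced H {c})"
  then show "{u, v} \<in> edges (induced H {c}) \<longleftrightarrow> {0, 0} \<in> edges (complete_graph 1)"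
    using simple_graph_edgeD(3)[OF assms(1), of c c] by (simp only: edge_induced edge_complete_graph) auto
qed

text \<open>In a 1-regular graph each vertex \<open>v\<close> lies in a unique edge
  \<open>E v\<close>. With the edges numbered by \<open>g\<close> and each edge \<open>e\<close>
  written as \<open>{l e, r e}\<close>, a vertex goes to the number of its edge, paired with 0 or 1
  according to which end it is.\<close>

lemma graph_iso_matching:
  assumes H: "simple_graph H" and deg: "\<And>v. v \<in> verts H \<Longrightarrow> card (nbrs H v) = 1"
  shows "graph_iso H (copies (graph_order H div 2) (complete_graph 2))"
proof -
  let ?t = "graph_size H"
  \<comment> \<open>All degrees being 1, the handshake identity makes the number of edges equal to
    half the order, which is the required number of copies.\<close>
  have "2 * ?t = graph_order H"
    using handshake[OF H] deg by (simp add: graph_order_def)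
  then have t: "graph_order H div 2 = ?t" by simp
  obtain g where g: "bij_betw g (edges H) {..<?t}"
    using simple_graph_finite(2)[OF H] ex_bij_betw_finite_nat
    unfolding graph_size_def atLeast0LessThan by metis
  define E where "E v = the_elem {e \<in> edges H. v \<in> e}" for v
  have E_eq: "{e \<in> edges H. v \<in> e} = {E v}" if "v \<in> verts H" for v
    using deg[OF that] card_incident_edges[OF H, of v] unfolding E_def
    by (metis card_1_singletonE the_elem_eq)
  have E: "E v \<in> edges H \<and> v \<in> E v" if "v \<in> verts H" for v
    using E_eq[OF that] by blast
  have E_unique: "e = E v" if "v \<in> verts H" "e \<in> edges H" "v \<in> e" for v e
    using E_eq[OF that(1)] that(2,3) by blast
  have "\<forall>e\<in>edges H. \<exists>x y. e = {x, y} \<and> x \<noteq> y"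
    using H by (auto simp: simple_graph_def card_2_iff)
  then obtain l r where lr: "\<And>e. e \<in> edges H \<Longrightarrow> e = {l e, r e} \<and> l e \<noteq> r e"
    by metis
  have lrV: "l e \<in> verts H" "r e \<in> verts H" if "e \<in> edges H" for e
    using that lr[OF that] H simple_graph_edgeD by metis+
  have lrE: "E (l e) = e" "E (r e) = e" if "e \<in> edges H" for e
    using that lr[OF that] lrV[OF that] E_unique by (metis insertI1 insertI2)+
  define f where "f v = (g (E v), if v = l (E v) then 0 else 1 :: nat)" for v
  have ends: "v = l (E v) \<or> v = r (E v)" if "v \<in> verts H" for v
    using E[OF that] lr[of "E v"] by blast
  have f: "bij_betw f (verts H) ({..<?t} \<times> {..<2})"
    unfolding bij_betw_def
  proof
    show "inj_on f (verts H)"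
    proof (rule inj_onI)
      fix u v assume uv: "u \<in> verts H" "v \<in> verts H" "f u = f v"
      then have "E u = E v"
        using E bij_betw_imp_inj_on[OF g] by (simp add: f_def inj_on_eq_iff)
      then show "u = v"
        using uv ends[of u] ends[of v] by (auto simp: f_def split: if_splits)
    qed
    show "f ` verts H = {..<?t} \<times> {..<2}"
    proof
      show "f ` verts H \<subseteq> {..<?t} \<times> {..<2}"
        using E bij_betwE[OF g] by (auto simp: f_def)
      show "{..<?t} \<times> {..<2} \<subseteq> f ` verts H"
      proof
        fix x :: "nat \<times> nat" assume "x \<in> {..<?t} \<times> {..<2}"
        then obtain i j where x: "x = (i, j)" "i < ?t" "j < 2" by auto
        obtain e where e: "e \<in> edges H" "g e = i"
          using x(2) bij_betw_imp_surj_on[OF g] by (metis imageE lessThan_iff)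
        have "f (l e) = (i, 0)" "f (r e) = (i, 1)"
          using e lr[OF e(1)] lrE[OF e(1)] by (auto simp: f_def)
        then show "x \<in> f ` verts H"
          using x(1,3) lrV[OF e(1)] by (auto simp: less_2_cases_iff intro: rev_image_eqI)
      qed
    qed
  qed
  moreover have "{u, v} \<in> edges H \<longleftrightarrow> {f u, f v} \<in> edges (copies ?t (complete_graph 2))"
    if uv: "u \<in> verts H" "v \<in> verts H" for u v
  proof
    assume e: "{u, v} \<in> edges H"
    have "{u, v} = E u" "{u, v} = E v" using E_unique uv e by blast+
    then have "E u = E v" by simp
    \<comment> \<open>Both images carry the same edge number, so being different they differ in the
      second coordinate, which is adjacency in \<open>complete_graph 2\<close>.\<close>
    moreover have "f u \<noteq> f v"
      using simple_graph_edgeD(3)[OF H e] uv bij_betw_imp_inj_on[OF f] by (auto simp: inj_on_eq_iff)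
    moreover have "g (E v) < ?t" using E[OF uv(2)] bij_betwE[OF g] by auto
    ultimately show "{f u, f v} \<in> edges (copies ?t (complete_graph 2))"
      by (auto simp: edge_copies edge_complete_graph f_def split: if_splits)
  next
    assume "{f u, f v} \<in> edges (copies ?t (complete_graph 2))"
    then have "g (E u) = g (E v)" "u \<noteq> v" by (auto simp: edge_copies edge_complete_graph f_def)
    then have "E u = E v" using E uv bij_betw_imp_inj_on[OF g] by (simp add: inj_on_eq_iff)
    then have "E u = {u, v}"
      using \<open>u \<noteq> v\<close> ends[OF uv(1)] ends[OF uv(2)] lr[of "E u"] E[OF uv(1)] by (metis insert_commute)
    then show "{u, v} \<in> edges H" using E[OF uv(1)] by simp
  qed
  ultimately show ?thesis unfolding graph_iso_def t by auto
qed

text \<open>The vertex \<open>b\<close> goes to the middle vertex 1 and its neighbours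
  \<open>a\<close>, \<open>d\<close> to the ends 0 and 2; \<open>d \<notin> nbrs H a\<close> keeps
  the three from forming a triangle.\<close>

lemma graph_iso_P3:
  assumes H: "simple_graph H" and b: "nbrs H b = {a, d}" and "a \<noteq> d" and "d \<notin> nbrs H a"
  shows "graph_iso (induced H {a, b, d}) (path_graph 3)"
proof -
  have "a \<noteq> b" "b \<noteq> d" using nbrs_subset[OF H, of b] b by auto
  define f where "f v = (if v = a then 0 else if v = b then 1 else 2 :: nat)" for v
  have three: "{..<3} = {0, 1, 2 :: nat}" by auto
  have "bij_betw f {a, b, d} {..<3}"
    unfolding three
    using \<open>a \<noteq> b\<close> \<open>b \<noteq> d\<close> \<open>a \<noteq> d\<close> by (auto simp: bij_betw_def inj_on_def f_def)
  moreover have e: "{b, a} \<in> edges H" "{b, d} \<in> edges H" "{a, d} \<notin> edges H"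
    using b assms(4) by (auto simp: nbrs_def)
  have e': "{a, b} \<in> edges H" "{d, b} \<in> edges H" "{d, a} \<notin> edges H"
    using e by (simp_all add: insert_commute)
  \<comment> \<open>For \<open>u = v\<close> the pair \<open>{u, v}\<close> collapses to a
    singleton, so the diagonal cases need this fact.\<close>
  have loop: "{x} \<notin> edges H" for x using H by (auto simp: simple_graph_def)
  have "{u, v} \<in> edges H \<longleftrightarrow> {f u, f v} \<in> edges (path_graph 3)"
    if "u \<in> {a, b, d}" "v \<in> {a, b, d}" for u v
    using that \<open>a \<noteq> b\<close> \<open>b \<noteq> d\<close> \<open>a \<noteq> d\<close>
    by (elim insertE emptyE) (simp_all add: e e' loop edges_path_graph_3 doubleton_eq_iff f_def)
  ultimately show ?thesis unfolding graph_iso_def by (auto simp: edge_induced)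
qed

subsection \<open>Distances and eccentricities\<close>

lemma graph_dist_le: "path_between G u p v \<Longrightarrow> length p = Suc k \<Longrightarrow> graph_dist G u v \<le> k"
  unfolding graph_dist_def by (rule Least_le) blast

text \<open>Connectivity supplies some path, so the \<open>LEAST\<close> in
  \<open>graph_dist\<close> is attained.\<close>

lemma graph_dist_path:
  assumes "connected_graph G" "u \<in> verts G" "v \<in> verts G"
  obtains p where "path_between G u p v" "length p = Suc (graph_dist G u v)"
proof -
  obtain p where p: "path_between G u p v" using assms by (auto simp: connected_graph_def)
  then have "length p = Suc (length p - 1)" by (cases p) (auto simp: path_between_def)
  with p have "\<exists>k p. path_between G u p v \<and> length p = Suc k" by blast
  from LeastI_ex[OF this] that show ?thesis unfolding graph_dist_def by blast
qed

lemma graph_dist_self: "u \<in> verts G \<Longrightarrow> graph_dist G u u = 0"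
  using graph_dist_le[of G u "[u]" u 0] by (simp add: path_between_def)

lemma path_between_adjacent:
  "simple_graph G \<Longrightarrow> {u, v} \<in> edges G \<Longrightarrow> path_between G u [u, v] v"
  by (auto simp: path_between_def dest: simple_graph_edgeD)

lemma path_between_common_neighbour:
  "simple_graph G \<Longrightarrow> {u, w} \<in> edges G \<Longrightarrow> {w, v} \<in> edges G \<Longrightarrow> u \<noteq> v \<Longrightarrow> path_between G u [u, w, v] v"
  by (auto simp: path_between_def dest: simple_graph_edgeD)

lemma graph_dist_adjacent: "simple_graph G \<Longrightarrow> {u, v} \<in> edges G \<Longrightarrow> graph_dist G u v \<le> 1"
  by (rule graph_dist_le[OF path_between_adjacent]) auto

lemma graph_dist_common_neighbour:
  "simple_graph G \<Longrightarrow> {u, w} \<in> edges G \<Longrightarrow> {w, v} \<in> edges G \<Longrightarrow> u \<noteq> v \<Longrightarrow> graph_dist G u v \<le> 2"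
  by (rule graph_dist_le[OF path_between_common_neighbour]) auto

lemma graph_dist_pos:
  assumes "connected_graph G" "u \<in> verts G" "v \<in> verts G" "u \<noteq> v"
  shows "1 \<le> graph_dist G u v"
proof (rule ccontr)
  assume "\<not> 1 \<le> graph_dist G u v"
  then obtain p where "path_between G u p v" "length p = 1"
    using graph_dist_path[OF assms(1-3)] by (metis One_nat_def less_one linorder_not_le)
  then show False using assms(4) by (auto simp: path_between_def length_Suc_conv)
qed

lemma graph_dist_nonadjacent:
  assumes "connected_graph G" "u \<in> verts G" "v \<in> verts G" "u \<noteq> v" "{u, v} \<notin> edges G"
  shows "2 \<le> graph_dist G u v"
proof (rule ccontr)
  assume "\<not> 2 \<le> graph_dist G u v"
  then have "graph_dist G u v = 1" using graph_dist_pos[OF assms(1-4)] by simp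
  then obtain p where "path_between G u p v" "length p = 2"
    using graph_dist_path[OF assms(1-3)] by (metis Suc_1)
  then show False using assms(5) by (auto simp: path_between_def length_Suc_conv numeral_2_eq_2)
qed

section \<open>Eccentricity, diameter and almost peripheral graphs\<close>

lemma eccentricity_le_iff:
  "connected_graph G \<Longrightarrow> eccentricity G v \<le> k \<longleftrightarrow> (\<forall>u\<in>verts G. graph_dist G v u \<le> k)"
  by (auto simp: eccentricity_def connected_graph_def simple_graph_finite)

lemma graph_dist_le_eccentricity:
  "connected_graph G \<Longrightarrow> u \<in> verts G \<Longrightarrow> graph_dist G v u \<le> eccentricity G v"
  using eccentricity_le_iff[of G v "eccentricity G v"] by simp

lemma graph_diameter_le_iff:
  "connected_graph G \<Longrightarrow> graph_diameter G \<le> k \<longleftrightarrow> (\<forall>u\<in>verts G. eccentricity G u \<le> k)"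
  by (auto simp: graph_diameter_def connected_graph_def simple_graph_finite)

text \<open>Here \<open>c\<close> is the one vertex whose eccentricity is below the diameter. The
  last alternative records what happens when \<open>c\<close> has a non-neighbour: the diameter is
  then at least 3, and two vertices at distance at least 3 have no common neighbour in
  \<open>G\<close>, so their complement neighbourhoods cover all vertices.\<close>

lemma almost_peripheral_center:
  assumes ap: "almost_peripheral G" and n: "graph_order G \<ge> 3"
  obtains c where "c \<in> verts G"
    and "\<And>v. v \<in> verts G \<Longrightarrow> v \<noteq> c \<Longrightarrow> nbrs (complement G) v \<noteq> {}"
    and "nbrs (complement G) c = {} \<or>
      (\<exists>u\<in>verts G. \<exists>v\<in>verts G. {u, v} \<in> edges (complement G) \<and>
         verts G = nbrs (complement G) u \<union> nbrs (complement G) v)"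
proof -
  have conn: "connected_graph G" and cardP: "card {v. peripheral G v} = graph_order G - 1"
    using ap by (auto simp: almost_peripheral_def)
  then have G: "simple_graph G" by (simp add: connected_graph_def)
  note fin = simple_graph_finite(1)[OF G]
  have "{v. peripheral G v} \<subseteq> verts G" by (auto simp: peripheral_def)
  then have "card (verts G - {v. peripheral G v}) = 1"
    using fin cardP n by (simp add: card_Diff_subset finite_subset graph_order_def)
  then obtain c where c: "verts G - {v. peripheral G v} = {c}" by (auto simp: card_1_singleton_iff)
  then have cV: "c \<in> verts G" by blast
  have ecc_le: "eccentricity G v \<le> graph_diameter G" if "v \<in> verts G" for v
    using graph_diameter_le_iff[OF conn] that by blast
  have ecc_c: "eccentricity G c < graph_diameter G"
    using c ecc_le[OF cV] by (auto simp: peripheral_def)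
  have ecc_v: "eccentricity G v = graph_diameter G" if "v \<in> verts G" "v \<noteq> c" for v
    using that c by (auto simp: peripheral_def)
  have far: "\<exists>u\<in>verts G. k < graph_dist G v u" if "v \<in> verts G" "v \<noteq> c" "k < graph_diameter G" for v k
    using that ecc_v eccentricity_le_iff[OF conn, of v k] by force
  have "\<not> verts G \<subseteq> {c}"
    using card_mono[of "{c}" "verts G"] n by (auto simp: graph_order_def)
  then obtain x where x: "x \<in> verts G" "x \<noteq> c" by blast
  have "1 \<le> eccentricity G c"
    using graph_dist_pos[OF conn cV x(1)] x graph_dist_le_eccentricity[OF conn x(1), of c] by simp
  with ecc_c have d2: "1 < graph_diameter G" by simp
  have nonadj: "nbrs (complement G) v \<noteq> {}" if v: "v \<in> verts G" "v \<noteq> c" for v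
  proof -
    obtain u where u: "u \<in> verts G" "1 < graph_dist G v u" using far[OF v d2] by blast
    then have "u \<noteq> v" "{v, u} \<notin> edges G"
      using graph_dist_self[OF v(1)] graph_dist_adjacent[OF G, of v u] by auto
    then show ?thesis using u v by (auto simp: nbrs_def edge_complement)
  qed
  have center: "\<exists>u\<in>verts G. \<exists>v\<in>verts G. {u, v} \<in> edges (complement G) \<and>
         verts G = nbrs (complement G) u \<union> nbrs (complement G) v"
    if "nbrs (complement G) c \<noteq> {}"
  proof -
    \<comment> \<open>The non-neighbour \<open>y\<close> of \<open>c\<close> serves twice: it forces
      eccentricity at least 2 on \<open>c\<close>, and, being peripheral, it has a vertex
      \<open>z\<close> at distance greater than 2.\<close>
    from that obtain y where y: "y \<in> verts G" "y \<noteq> c" "{c, y} \<notin> edges G"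
      by (auto simp: nbrs_def edge_complement)
    have "2 \<le> eccentricity G c"
      using graph_dist_nonadjacent[OF conn cV y(1)] y graph_dist_le_eccentricity[OF conn y(1), of c]
      by simp
    with ecc_c have "2 < graph_diameter G" by simp
    then obtain z where z: "z \<in> verts G" "2 < graph_dist G y z" using far[OF y(1,2)] by blast
    have yz: "y \<noteq> z" "{y, z} \<notin> edges G"
      using z y graph_dist_self[of z G] graph_dist_adjacent[OF G, of y z] by auto
    \<comment> \<open>A \<open>w\<close> other than \<open>y\<close> and \<open>z\<close> outside
      both sets would be a common neighbour in \<open>G\<close>, giving distance at most 2. The
      vertices \<open>y\<close> and \<open>z\<close> are covered by their own complement
      edge.\<close>
    have "w \<in> nbrs (complement G) y \<union> nbrs (complement G) z" if w: "w \<in> verts G" for w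
      using graph_dist_common_neighbour[OF G, of y w z] yz z y w
      by (auto simp: nbrs_def edge_complement insert_commute)
    moreover have "nbrs (complement G) v \<subseteq> verts G" for v
      by (auto simp: nbrs_def edge_complement)
    ultimately have "verts G = nbrs (complement G) y \<union> nbrs (complement G) z" by blast
    with yz y(1) z(1) show ?thesis by (auto simp: edge_complement)
  qed
  show ?thesis using that cV nonadj center by blast
qed

text \<open>Any two vertices are joined through the universal vertex \<open>c\<close>, so all
  distances are at most 2. A vertex other than \<open>c\<close> has a non-neighbour and hence
  eccentricity exactly 2, whereas \<open>c\<close> has at most 1.\<close>

lemma almost_peripheralI:
  assumes G: "simple_graph G" and c: "c \<in> verts G" and n: "graph_order G \<ge> 2"
    and univ: "\<And>v. v \<in> verts G \<Longrightarrow> v \<noteq> c \<Longrightarrow> {c, v} \<in> edges G"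
    and nonadj: "\<And>v. v \<in> verts G \<Longrightarrow> v \<noteq> c \<Longrightarrow> nbrs (complement G) v \<noteq> {}"
  shows "almost_peripheral G"
proof -
  note fin = simple_graph_finite(1)[OF G]
  have univ': "{v, c} \<in> edges G" if "v \<in> verts G" "v \<noteq> c" for v
    using univ[OF that] by (simp add: insert_commute)
  have "\<exists>p. path_between G u p v" if uv: "u \<in> verts G" "v \<in> verts G" for u v
  proof -
    consider "u = v" | "u \<noteq> v" "u = c" | "u \<noteq> v" "v = c" | "u \<noteq> v" "u \<noteq> c" "v \<noteq> c" by blast
    then show ?thesis
    proof cases
      case 1
      then have "path_between G u [u] v" using uv by (simp add: path_between_def)
      then show ?thesis by blast
    next
      case 2
      with uv show ?thesis using path_between_adjacent[OF G univ[of v]] by blast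
    next
      case 3
      with uv show ?thesis using path_between_adjacent[OF G univ'[of u]] by blast
    next
      case 4
      with uv show ?thesis
        using path_between_common_neighbour[OF G univ'[of u] univ[of v]] by blast
    qed
  qed
  then have conn: "connected_graph G" using G c by (auto simp: connected_graph_def)
  have "eccentricity G c \<le> 1"
    unfolding eccentricity_le_iff[OF conn]
    using graph_dist_self[OF c] graph_dist_adjacent[OF G univ] by (metis le0)
  have ecc2: "eccentricity G v = 2" if v: "v \<in> verts G" "v \<noteq> c" for v
  proof (rule antisym)
    show "eccentricity G v \<le> 2"
      unfolding eccentricity_le_iff[OF conn]
    proof
      fix u assume u: "u \<in> verts G"
      consider "u = v" | "u \<noteq> v" "u = c" | "u \<noteq> v" "u \<noteq> c" by blast
      then show "graph_dist G v u \<le> 2"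
      proof cases
        case 1 then show ?thesis using graph_dist_self[OF u] by simp
      next
        case 2 then show ?thesis using graph_dist_adjacent[OF G univ'[OF v]] by simp
      next
        case 3 then show ?thesis using graph_dist_common_neighbour[OF G univ'[OF v] univ[OF u]] by simp
      qed
    qed
    obtain u where "{v, u} \<in> edges (complement G)" using nonadj[OF v] by (auto simp: nbrs_def)
    then show "2 \<le> eccentricity G v"
      using graph_dist_nonadjacent[OF conn, of v u] graph_dist_le_eccentricity[OF conn, of u v]
      by (simp add: edge_complement)
  qed
  \<comment> \<open>Some vertex besides \<open>c\<close> must exist for the diameter to reach
    2.\<close>
  have "card (verts G - {c}) \<ge> 1" using n c fin by (simp add: graph_order_def)
  then obtain x where x: "x \<in> verts G" "x \<noteq> c"
    by (metis Diff_iff card.empty ex_in_conv insertI1 not_one_le_zero)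
  have "graph_diameter G = 2"
  proof (rule antisym)
    show "graph_diameter G \<le> 2"
      unfolding graph_diameter_le_iff[OF conn]
      using ecc2 \<open>eccentricity G c \<le> 1\<close> by (metis le_trans one_le_numeral order_refl)
    show "2 \<le> graph_diameter G"
      using graph_diameter_le_iff[OF conn, of "graph_diameter G"] ecc2[OF x] x by auto
  qed
  then have "{v. peripheral G v} = verts G - {c}"
    using ecc2 \<open>eccentricity G c \<le> 1\<close> by (auto simp: peripheral_def)
  then show ?thesis
    using conn fin c by (simp add: almost_peripheral_def graph_order_def)
qed

subsection \<open>The extremal graphs\<close>

text \<open>The extremal graphs live on sum types, while attainment is stated for graphs on
  \<open>nat\<close>; \<open>to_nat\<close> relabels the vertices. The hypotheses repeat those of
  \<open>almost_peripheralI\<close>, so that it can be applied to the relabelled graph without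
  transporting paths and distances.\<close>

lemma almost_peripheral_nat_copy:
  fixes G :: "'a::countable ugraph"
  assumes G: "simple_graph G" and c: "c \<in> verts G" and n: "graph_order G \<ge> 2"
    and univ: "\<And>v. v \<in> verts G \<Longrightarrow> v \<noteq> c \<Longrightarrow> {c, v} \<in> edges G"
    and nonadj: "\<And>v. v \<in> verts G \<Longrightarrow> v \<noteq> c \<Longrightarrow> nbrs (complement G) v \<noteq> {}"
  shows "\<exists>G' :: nat ugraph. almost_peripheral G' \<and> graph_order G' = graph_order G \<and>
    graph_size G' = graph_size G"
proof -
  define f where "f = (to_nat :: 'a \<Rightarrow> nat)"
  have f: "inj f" by (simp add: f_def)
  have inj_image: "inj ((`) f)" using f by (auto intro!: injI simp: inj_image_eq_iff)
  define G' where "G' = \<lparr>verts = f ` verts G, edges = (`) f ` edges G\<rparr>"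
  have edge: "{f u, f v} \<in> edges G' \<longleftrightarrow> {u, v} \<in> edges G" for u v
    using inj_image_mem_iff[OF inj_image, of "{u, v}" "edges G"] by (simp add: G'_def)
  have order: "graph_order G' = graph_order G"
    by (simp add: graph_order_def G'_def card_image inj_on_subset[OF f])
  have "graph_size G' = graph_size G"
    by (simp add: graph_size_def G'_def card_image inj_on_subset[OF inj_image])
  moreover have "almost_peripheral G'"
  proof (rule almost_peripheralI[of _ "f c"])
    show "simple_graph G'"
      using G by (auto simp: simple_graph_def G'_def card_image inj_on_subset[OF f])
    show "f c \<in> verts G'" "graph_order G' \<ge> 2" using c n order by (simp_all add: G'_def)
    fix w assume "w \<in> verts G'" "w \<noteq> f c"
    then obtain v where v: "w = f v" "v \<in> verts G" "v \<noteq> c" by (auto simp: G'_def)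
    show "{f c, w} \<in> edges G'" unfolding v(1) edge by (rule univ[OF v(2,3)])
    obtain u where u: "{v, u} \<in> edges (complement G)" using nonadj[OF v(2,3)] by (auto simp: nbrs_def)
    then have "{f v, f u} \<in> edges (complement G')"
      by (auto simp: edge_complement edge inj_eq[OF f]) (simp_all add: G'_def)
    then show "nbrs (complement G') w \<noteq> {}" using v(1) by (auto simp: nbrs_def)
  qed
  ultimately show ?thesis using order by blast
qed

lemma order_matching_K1: "graph_order (disjoint_union (complete_graph 1) (copies t (complete_graph 2))) = 2 * t + 1"
  by (simp add: order_disjoint_union order_copies simple_complete_graph simple_copies)

lemma size_matching_K1: "graph_size (disjoint_union (complete_graph 1) (copies t (complete_graph 2))) = t"
  by (simp add: size_disjoint_union size_copies size_complete_graph simple_complete_graph simple_copies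
      binomial_eq_0)

text \<open>On the vertices 0 and 1, \<open>1 - v\<close> is the other vertex.\<close>

lemma nbrs_complete_graph_2: "v < 2 \<Longrightarrow> 1 - v \<in> nbrs (complete_graph 2) v"
  by (auto simp: nbrs_def edge_complete_graph less_2_cases_iff)

lemma nbrs_copies_K2: "v \<in> verts (copies t (complete_graph 2)) \<Longrightarrow>
    nbrs (copies t (complete_graph 2)) v \<noteq> {}"
  using nbrs_complete_graph_2[of "snd v"] by (force simp: nbrs_def edge_copies)

lemma nbrs_disjoint_union [simp]:
  "nbrs (disjoint_union G H) (Inl u) = Inl ` nbrs G u"
  "nbrs (disjoint_union G H) (Inr v) = Inr ` nbrs H v"
proof -
  have "x \<in> nbrs (disjoint_union G H) (Inl u) \<longleftrightarrow> x \<in> Inl ` nbrs G u"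
    "x \<in> nbrs (disjoint_union G H) (Inr v) \<longleftrightarrow> x \<in> Inr ` nbrs H v" for x
    by (cases x; auto simp: nbrs_def)+
  then show "nbrs (disjoint_union G H) (Inl u) = Inl ` nbrs G u"
    "nbrs (disjoint_union G H) (Inr v) = Inr ` nbrs H v"
    by blast+
qed

text \<open>With \<open>n = 2 * t + 1\<close> the complement \<open>H\<close> has \<open>t\<close>
  edges, and removing them from all pairs leaves \<open>2 * t * t\<close>. The vertex
  \<open>Inl 0\<close> of the \<open>K_1\<close> is isolated in \<open>H\<close>, hence universal in
  the extremal graph.\<close>

lemma extremal_odd:
  assumes "n \<ge> 3" "odd n"
  shows "simple_graph (extremal_odd n)" "graph_order (extremal_odd n) = n"
    "graph_size (extremal_odd n) = (n - 1)^2 div 2" "almost_peripheral (extremal_odd n)"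
    "\<exists>G :: nat ugraph. almost_peripheral G \<and> graph_order G = n \<and> graph_size G = (n - 1)^2 div 2"
proof -
  define t where "t = (n - 1) div 2"
  define H where "H = disjoint_union (complete_graph 1) (copies t (complete_graph 2))"
  have n: "n = 2 * t + 1" using assms by (auto simp: t_def elim: oddE)
  have G: "extremal_odd n = complement H" by (simp add: extremal_odd_def H_def t_def)
  have H: "simple_graph H"
    unfolding H_def by (intro simple_disjoint_union simple_copies simple_complete_graph)
  have order: "graph_order H = n" and size: "graph_size H = t"
    unfolding H_def order_matching_K1 size_matching_K1 n by simp_all
  show simple: "simple_graph (extremal_odd n)"
    unfolding G by (rule simple_graph_complement) (rule simple_graph_finite[OF H])
  show order': "graph_order (extremal_odd n) = n"
    using order by (simp add: G graph_order_def)
  have "n choose 2 = t + 2 * t * t"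
    by (simp add: choose_two n algebra_simps)
  then have "graph_size (extremal_odd n) = 2 * t * t"
    using graph_size_complement[OF H] unfolding G order size by simp
  then show size': "graph_size (extremal_odd n) = (n - 1)^2 div 2"
    by (simp add: n power2_eq_square)
  have c: "Inl 0 \<in> verts (extremal_odd n)"
    by (auto simp: G H_def)
  have nbrs: "{Inl 0, v} \<in> edges (extremal_odd n)" "nbrs (complement (extremal_odd n)) v \<noteq> {}"
    if v: "v \<in> verts (extremal_odd n)" "v \<noteq> Inl 0" for v
  proof -
    from v obtain x where x: "v = Inr x" "x \<in> verts (copies t (complete_graph 2))"
      by (auto simp: G H_def)
    then have univ: "{Inl 0, v} \<in> edges (extremal_odd n)"
      unfolding G edge_complement by (auto simp: H_def)
    have nonadj: "nbrs (complement (extremal_odd n)) v \<noteq> {}"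
      unfolding G complement_complement[OF H]
      using nbrs_copies_K2[OF x(2)] x(1) by (simp add: H_def)
    show "{Inl 0, v} \<in> edges (extremal_odd n)" "nbrs (complement (extremal_odd n)) v \<noteq> {}"
      by (rule univ, rule nonadj)
  qed
  have ge2: "2 \<le> graph_order (extremal_odd n)" using order' assms by simp
  show "almost_peripheral (extremal_odd n)"
    by (rule almost_peripheralI[OF simple c ge2 nbrs])
  show "\<exists>G :: nat ugraph. almost_peripheral G \<and> graph_order G = n \<and> graph_size G = (n - 1)^2 div 2"
    using almost_peripheral_nat_copy[OF simple c ge2 nbrs] unfolding order' size' .
qed

text \<open>As in the odd case, with \<open>n = 2 * t + 4\<close> and \<open>t + 2\<close>
  complement edges, two of them from the path. The universal vertex is now
  \<open>Inl (Inl 0)\<close>.\<close>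

lemma extremal_even:
  assumes "n \<ge> 3" "even n"
  shows "simple_graph (extremal_even n)" "graph_order (extremal_even n) = n"
    "graph_size (extremal_even n) = (n - 1)^2 div 2" "almost_peripheral (extremal_even n)"
    "\<exists>G :: nat ugraph. almost_peripheral G \<and> graph_order G = n \<and> graph_size G = (n - 1)^2 div 2"
proof -
  define t where "t = (n - 4) div 2"
  define K where "K = disjoint_union (complete_graph 1) (copies t (complete_graph 2))"
  define H where "H = disjoint_union K (path_graph 3)"
  \<comment> \<open>An even \<open>n >= 3\<close> is at least 4, so the subtraction
    \<open>n - 4\<close> is not truncated.\<close>
  have n: "n = 2 * t + 4" using assms by (auto simp: t_def elim: evenE)
  have G: "extremal_even n = complement H" by (simp add: extremal_even_def H_def K_def t_def)
  have K: "simple_graph K"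
    unfolding K_def by (intro simple_disjoint_union simple_copies simple_complete_graph)
  then have H: "simple_graph H"
    unfolding H_def by (intro simple_disjoint_union simple_path_graph)
  have "graph_order K = 2 * t + 1" "graph_size K = t"
    unfolding K_def by (rule order_matching_K1, rule size_matching_K1)
  moreover have "graph_order (path_graph 3) = 3"
    by (simp add: graph_order_def)
  ultimately have order: "graph_order H = n" and size: "graph_size H = t + 2"
    by (simp_all add: H_def order_disjoint_union size_disjoint_union K simple_path_graph
        size_path_graph_3 n)
  show simple: "simple_graph (extremal_even n)"
    unfolding G by (rule simple_graph_complement) (rule simple_graph_finite[OF H])
  show order': "graph_order (extremal_even n) = n"
    using order by (simp add: G graph_order_def)
  have "n choose 2 = (t + 2) * (2 * t + 3)"
    by (simp add: choose_two n algebra_simps)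
  \<comment> \<open>The square is odd here; the trailing 1 is what the floor discards.\<close>
  moreover have "(n - 1)^2 = 2 * ((t + 2) * (2 * t + 3) - (t + 2)) + 1"
    by (simp add: n power2_eq_square algebra_simps)
  ultimately show size': "graph_size (extremal_even n) = (n - 1)^2 div 2"
    using graph_size_complement[OF H] unfolding G order size by simp
  have c: "Inl (Inl 0) \<in> verts (extremal_even n)"
    by (auto simp: G H_def K_def)
  have nbrs: "{Inl (Inl 0), v} \<in> edges (extremal_even n)" "nbrs (complement (extremal_even n)) v \<noteq> {}"
    if v: "v \<in> verts (extremal_even n)" "v \<noteq> Inl (Inl 0)" for v
  proof -
    from v consider x where "v = Inl (Inr x)" "x \<in> verts (copies t (complete_graph 2))"
      | i where "v = Inr i" "i < 3"
      by (auto simp: G H_def K_def)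
    note cases_v = this
    then have univ: "{Inl (Inl 0), v} \<in> edges (extremal_even n)"
      unfolding G edge_complement by cases (auto simp: H_def K_def)
    from cases_v have nonadj: "nbrs (complement (extremal_even n)) v \<noteq> {}"
      unfolding G complement_complement[OF H]
    proof cases
      case (1 x)
      then show "nbrs H v \<noteq> {}"
        using nbrs_copies_K2[OF 1(2)] by (simp add: H_def K_def)
    next
      case (2 i)
      \<comment> \<open>The middle vertex 1 is given the neighbour 0, and each end the neighbour
        1.\<close>
      then have "{i, if i = 1 then 0 else 1} \<in> edges (path_graph 3)"
        by (auto simp: edges_path_graph_3 doubleton_eq_iff)
      then show "nbrs H v \<noteq> {}"
        unfolding 2 H_def nbrs_disjoint_union by (auto simp: nbrs_def simp del: if_split)
    qed
    show "{Inl (Inl 0), v} \<in> edges (extremal_even n)" "nbrs (complement (extremal_even n)) v \<noteq> {}"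
      by (rule univ, rule nonadj)
  qed
  have ge2: "2 \<le> graph_order (extremal_even n)" using order' assms by simp
  show "almost_peripheral (extremal_even n)"
    by (rule almost_peripheralI[OF simple c ge2 nbrs])
  show "\<exists>G :: nat ugraph. almost_peripheral G \<and> graph_order G = n \<and> graph_size G = (n - 1)^2 div 2"
    using almost_peripheral_nat_copy[OF simple c ge2 nbrs] unfolding order' size' .
qed

text \<open>The matching pairs \<open>2 * i\<close> with \<open>2 * i + 1\<close>. Sending
  \<open>(i, j)\<close> to \<open>2 * i + j\<close> carries the \<open>i\<close>-th copy of
  \<open>K_2\<close> onto the \<open>i\<close>-th pair, so the edges missing on both sides
  correspond.\<close>

lemma extremal_odd_join:
  assumes "n \<ge> 3" "odd n"
  shows "\<exists>M. perfect_matching (complete_graph (n - 1)) M \<and>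
     graph_iso (extremal_odd n)
       (graph_join (complete_graph 1) (delete_edges (complete_graph (n - 1)) M))"
proof -
  define t where "t = (n - 1) div 2"
  have n: "n - 1 = 2 * t" using assms by (auto simp: t_def elim: oddE)
  define M where "M = (\<lambda>i. {2 * i, 2 * i + 1}) ` {..<t}"
  \<comment> \<open>Two distinct numbers are matched when they have the same quotient by 2;
    adjacency in the join then reduces to comparing quotients.\<close>
  have M_iff: "{u, v} \<in> M \<longleftrightarrow> u div 2 = v div 2 \<and> u div 2 < t \<and> u \<noteq> v" for u v :: nat
  proof
    assume "{u, v} \<in> M"
    then obtain i where "i < t" "u = 2 * i \<and> v = 2 * i + 1 \<or> u = 2 * i + 1 \<and> v = 2 * i"
      by (auto simp: M_def doubleton_eq_iff)
    then show "u div 2 = v div 2 \<and> u div 2 < t \<and> u \<noteq> v" by auto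
  next
    assume a: "u div 2 = v div 2 \<and> u div 2 < t \<and> u \<noteq> v"
    have parity: "x = 2 * (x div 2) \<or> x = 2 * (x div 2) + 1" for x :: nat by presburger
    have "{u, v} = {2 * (u div 2), 2 * (u div 2) + 1}"
      using a parity[of u] parity[of v] unfolding doubleton_eq_iff by metis
    with a show "{u, v} \<in> M" unfolding M_def by blast
  qed
  have "perfect_matching (complete_graph (n - 1)) M"
    unfolding perfect_matching_def
  proof (intro conjI ballI)
    show "M \<subseteq> edges (complete_graph (n - 1))"
      unfolding M_def n by (auto simp: edge_complete_graph)
    fix v assume "v \<in> verts (complete_graph (n - 1))"
    then have v: "v div 2 < t" unfolding n by auto
    show "\<exists>!e. e \<in> M \<and> v \<in> e"
    proof (rule ex1I[of _ "{2 * (v div 2), 2 * (v div 2) + 1}"])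
      have "v = 2 * (v div 2) \<or> v = 2 * (v div 2) + 1" by presburger
      then show "{2 * (v div 2), 2 * (v div 2) + 1} \<in> M \<and> v \<in> {2 * (v div 2), 2 * (v div 2) + 1}"
        using v unfolding M_def by blast
    qed (auto simp: M_def)
  qed
  moreover
  define J where "J = graph_join (complete_graph 1) (delete_edges (complete_graph (n - 1)) M)"
  define f :: "nat + nat \<times> nat \<Rightarrow> nat + nat"
    where "f = map_sum (\<lambda>x. x) (\<lambda>(i, j). 2 * i + j)"
  have vJ: "verts J = {..<1} <+> {..<2 * t}"
    unfolding J_def graph_join_def delete_edges_def n by simp
  have vG: "verts (extremal_odd n) = {..<1} <+> ({..<t} \<times> {..<2})"
    by (simp add: extremal_odd_def t_def)
  \<comment> \<open>The inverse is division by 2 with remainder.\<close>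
  have "bij_betw f (verts (extremal_odd n)) (verts J)"
    unfolding vJ vG
    by (rule bij_betw_byWitness[where f' = "map_sum (\<lambda>x. x) (\<lambda>k. (k div 2, k mod 2))"])
      (auto simp: f_def)
  moreover have "{u, v} \<in> edges (extremal_odd n) \<longleftrightarrow> {f u, f v} \<in> edges J"
    if uv: "u \<in> verts (extremal_odd n)" "v \<in> verts (extremal_odd n)" for u v
  proof -
    have J_ll: "{Inl x, Inl y} \<notin> edges J" if "x < 1" "y < 1" for x y
    proof -
      have "{Inl x, Inl y} \<in> edges J \<longleftrightarrow> {x, y} \<in> edges (complete_graph 1)"
        unfolding J_def graph_join_def by (auto simp: doubleton_eq_iff)
      then show ?thesis using that by (simp add: edge_complete_graph)
    qed
    have J_lr: "{Inl x, Inr y} \<in> edges J" "{Inr y, Inl x} \<in> edges J" if "x < 1" "y < 2 * t" for x y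
      using that unfolding J_def graph_join_def delete_edges_def n
      by (auto simp: insert_commute)
    have J_rr: "{Inr x, Inr y} \<in> edges J \<longleftrightarrow> x < 2 * t \<and> y < 2 * t \<and> x div 2 \<noteq> y div 2" for x y
    proof -
      have "{Inr x, Inr y} \<in> edges J \<longleftrightarrow> {x, y} \<in> edges (complete_graph (n - 1)) \<and> {x, y} \<notin> M"
        unfolding J_def graph_join_def by (auto simp: doubleton_eq_iff delete_edges_def)
      also have "\<dots> \<longleftrightarrow> x < 2 * t \<and> y < 2 * t \<and> x div 2 \<noteq> y div 2"
        unfolding edge_complete_graph M_iff n by auto
      finally show ?thesis .
    qed
    have G: "extremal_odd n = complement (disjoint_union (complete_graph 1) (copies t (complete_graph 2)))"
      by (simp add: extremal_odd_def t_def)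
    from uv consider "u = Inl 0" "v = Inl 0"
      | i j where "u = Inl 0" "v = Inr (i, j)" "i < t" "j < 2"
      | i j where "u = Inr (i, j)" "v = Inl 0" "i < t" "j < 2"
      | i j k l where "u = Inr (i, j)" "v = Inr (k, l)" "i < t" "j < 2" "k < t" "l < 2"
      unfolding vG by auto
    then show ?thesis
    proof cases
      case 1
      then show ?thesis using J_ll[of 0 0] unfolding G edge_complement by (simp add: f_def)
    next
      case 2
      then show ?thesis using J_lr(1)[of 0 "2 * i + j"] unfolding G edge_complement
        by (auto simp: f_def)
    next
      case 3
      then show ?thesis using J_lr(2)[of 0 "2 * i + j"] unfolding G edge_complement
        by (auto simp: f_def)
    next
      case 4
      then show ?thesis unfolding G edge_complement
        by (auto simp: f_def J_rr edge_copies edge_complete_graph)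
    qed
  qed
  ultimately show ?thesis unfolding graph_iso_def J_def by blast
qed

subsection \<open>Bound and uniqueness\<close>

text \<open>All vertices except possibly \<open>c\<close> contribute at least 1 to the degree sum of
  the complement.\<close>

lemma almost_peripheral_complement_size:
  assumes ap: "almost_peripheral G" and n: "graph_order G \<ge> 3"
  shows "graph_order G - 1 \<le> 2 * graph_size (complement G)"
proof -
  have G: "simple_graph G" using ap by (simp add: almost_peripheral_def connected_graph_def)
  note fin = simple_graph_finite(1)[OF G]
  let ?H = "complement G"
  have H: "simple_graph ?H" using fin by (rule simple_graph_complement)
  obtain c where c: "c \<in> verts G" "\<And>v. v \<in> verts G \<Longrightarrow> v \<noteq> c \<Longrightarrow> nbrs ?H v \<noteq> {}"
    using almost_peripheral_center[OF ap n] by metis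
  have "(\<Sum>v\<in>verts G - {c}. 1) \<le> (\<Sum>v\<in>verts G - {c}. card (nbrs ?H v))"
    using c(2) finite_nbrs[OF H] by (intro sum_mono) (simp add: Suc_le_eq card_gt_0_iff)
  also have "\<dots> \<le> (\<Sum>v\<in>verts G. card (nbrs ?H v))"
    using fin by (intro sum_mono2) auto
  finally show ?thesis
    using handshake[OF H] c(1) fin by (simp add: graph_order_def)
qed

text \<open>Otherwise the covering pair \<open>u\<close>, \<open>v\<close> contributes at least
  \<open>n\<close> to the complement degree sum, where \<open>n\<close> is the order, and the other
  \<open>n - 2\<close> vertices at least 1 each. The total of at least \<open>2 * n - 2\<close>
  exceeds \<open>n\<close> because \<open>n >= 3\<close>.\<close>

lemma complement_center_isolated:
  assumes ap: "almost_peripheral G" and n: "graph_order G \<ge> 3"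
    and small: "2 * graph_size (complement G) \<le> graph_order G"
      "graph_order G = 3 \<Longrightarrow> 2 * graph_size (complement G) \<le> 2"
  obtains c where "c \<in> verts G" "nbrs (complement G) c = {}"
    "\<And>v. v \<in> verts G \<Longrightarrow> v \<noteq> c \<Longrightarrow> nbrs (complement G) v \<noteq> {}"
proof -
  have G: "simple_graph G" using ap by (simp add: almost_peripheral_def connected_graph_def)
  note fin = simple_graph_finite(1)[OF G]
  let ?H = "complement G"
  let ?d = "\<lambda>v. card (nbrs ?H v)"
  have H: "simple_graph ?H" using fin by (rule simple_graph_complement)
  obtain c where c: "c \<in> verts G" "\<And>v. v \<in> verts G \<Longrightarrow> v \<noteq> c \<Longrightarrow> nbrs ?H v \<noteq> {}"
    and alt: "nbrs ?H c = {} \<or> (\<exists>u\<in>verts G. \<exists>v\<in>verts G. {u, v} \<in> edges ?H \<and>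
         verts G = nbrs ?H u \<union> nbrs ?H v)"
    by (rule almost_peripheral_center[OF ap n]) (rule that)
  have "nbrs ?H c = {}"
  proof (rule ccontr)
    assume ne: "nbrs ?H c \<noteq> {}"
    with alt obtain u v where uv: "u \<in> verts G" "v \<in> verts G" "{u, v} \<in> edges ?H"
      "verts G = nbrs ?H u \<union> nbrs ?H v" by blast
    have "u \<noteq> v" using simple_graph_edgeD(3)[OF H uv(3)] .
    have "graph_order G \<le> ?d u + ?d v"
      unfolding graph_order_def uv(4) by (rule card_Un_le)
    \<comment> \<open>Under the assumption \<open>ne\<close> even \<open>c\<close> has positive
      complement degree, so it may be among these \<open>w\<close>.\<close>
    moreover have "(\<Sum>w\<in>verts G - {u, v}. 1) \<le> (\<Sum>w\<in>verts G - {u, v}. ?d w)"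
      using c(2) ne finite_nbrs[OF H]
      by (intro sum_mono) (metis Diff_iff One_nat_def Suc_le_eq card_gt_0_iff)
    moreover have "(\<Sum>w\<in>verts G. ?d w) = (\<Sum>w\<in>{u, v}. ?d w) + (\<Sum>w\<in>verts G - {u, v}. ?d w)"
      using fin uv(1,2) by (subst sum.subset_diff[of "{u, v}"]) auto
    moreover have "card (verts G - {u, v}) = graph_order G - 2"
      using fin uv(1,2) \<open>u \<noteq> v\<close> by (simp add: card_Diff_subset graph_order_def)
    ultimately have "2 * graph_order G - 2 \<le> 2 * graph_size ?H"
      using handshake[OF H] \<open>u \<noteq> v\<close> n by simp
    with small n show False by linarith
  qed
  with c that show ?thesis by blast
qed

text \<open>Outside \<open>c\<close> there are \<open>n - 1\<close> positive degrees with sum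
  \<open>n - 1\<close>, so each is 1 and \<open>graph_iso_matching\<close> applies to the complement
  without \<open>c\<close>.\<close>

lemma unique_odd:
  assumes ap: "almost_peripheral G" and n: "graph_order G = n" "n \<ge> 3" "odd n"
    and size: "2 * graph_size (complement G) = n - 1"
  shows "graph_iso G (extremal_odd n)"
proof -
  have G: "simple_graph G" using ap by (simp add: almost_peripheral_def connected_graph_def)
  note fin = simple_graph_finite(1)[OF G]
  define H where "H = complement G"
  let ?d = "\<lambda>v. card (nbrs H v)"
  have H: "simple_graph H" unfolding H_def using fin by (rule simple_graph_complement)
  have VH: "verts H = verts G" by (simp add: H_def)
  obtain c where c: "c \<in> verts G" "nbrs H c = {}"
    "\<And>v. v \<in> verts G \<Longrightarrow> v \<noteq> c \<Longrightarrow> nbrs H v \<noteq> {}"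
    using complement_center_isolated[OF ap] n size by (auto simp: H_def)
  let ?S = "verts G - {c}"
  have pos: "1 \<le> ?d v" if "v \<in> ?S" for v
    using that c(3) finite_nbrs[OF H] by (simp add: Suc_le_eq card_gt_0_iff)
  have cardS: "card ?S = n - 1" using c(1) n fin by (simp add: graph_order_def)
  have "(\<Sum>v\<in>?S. ?d v) = n - 1"
    using handshake[OF H] size c fin by (simp add: VH H_def[symmetric] sum.remove)
  \<comment> \<open>Summing the excess over 1 is exact on naturals because every degree here is at
    least 1.\<close>
  then have "(\<Sum>v\<in>?S. ?d v - 1) = 0"
    using pos cardS by (subst sum_subtractf_nat) auto
  then have "\<forall>v\<in>?S. ?d v - 1 = 0"
    by (simp only: sum_eq_0_iff finite_Diff[OF fin])
  then have deg1: "?d v = 1" if "v \<in> ?S" for v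
    using that pos[OF that] by force
  have noedge: "{c, v} \<notin> edges H" for v using c(2) by (auto simp: nbrs_def)
  \<comment> \<open>Restricting to \<open>?S\<close> loses no neighbour, since the only vertex
    removed is isolated in \<open>H\<close>.\<close>
  have nbrsS: "nbrs (induced H ?S) v = nbrs H v" if "v \<in> ?S" for v
  proof -
    have "c \<notin> nbrs H v" using c(2) nbrs_sym[of c H v] by simp
    then show ?thesis
      using that nbrs_subset[OF H, of v] by (auto simp: nbrs_def edge_induced VH)
  qed
  have "graph_iso (induced H ?S) (copies (graph_order (induced H ?S) div 2) (complete_graph 2))"
    by (rule graph_iso_matching) (simp_all add: simple_induced H VH nbrsS deg1)
  moreover have "graph_order (induced H ?S) = n - 1" using cardS by (simp add: graph_order_def)
  ultimately have "graph_iso H (disjoint_union (complete_graph 1) (copies ((n - 1) div 2) (complete_graph 2)))"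
    using c(1) noedge
    by (intro graph_iso_disjoint_union[where A = "{c}" and B = ?S] graph_iso_K1[OF H])
      (auto simp: VH)
  from graph_iso_complement[OF this] show ?thesis
    by (simp add: H_def complement_complement[OF G] extremal_odd_def)
qed

text \<open>Now the total excess over degree 1 is 1, so a single vertex \<open>b\<close> has degree
  2. Its neighbours have degree 1 and so no neighbour but \<open>b\<close>, which makes
  \<open>{a, b, d}\<close> a path component; apart from \<open>c\<close>, the remaining vertices
  form a matching.\<close>

lemma unique_even:
  assumes ap: "almost_peripheral G" and n: "graph_order G = n" "n \<ge> 3" "even n"
    and size: "2 * graph_size (complement G) = n"
  shows "graph_iso G (extremal_even n)"
proof -
  have G: "simple_graph G" using ap by (simp add: almost_peripheral_def connected_graph_def)
  note fin = simple_graph_finite(1)[OF G]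
  define H where "H = complement G"
  let ?d = "\<lambda>v. card (nbrs H v)"
  have H: "simple_graph H" unfolding H_def using fin by (rule simple_graph_complement)
  have VH: "verts H = verts G" by (simp add: H_def)
  have "n \<noteq> 3" using n(3) by auto
  then obtain c where c: "c \<in> verts G" "nbrs H c = {}"
    "\<And>v. v \<in> verts G \<Longrightarrow> v \<noteq> c \<Longrightarrow> nbrs H v \<noteq> {}"
    using complement_center_isolated[OF ap] n size by (auto simp: H_def)
  let ?S = "verts G - {c}"
  have pos: "1 \<le> ?d v" if "v \<in> ?S" for v
    using that c(3) finite_nbrs[OF H] by (simp add: Suc_le_eq card_gt_0_iff)
  have cardS: "card ?S = n - 1" using c(1) n fin by (simp add: graph_order_def)
  have "(\<Sum>v\<in>?S. ?d v) = n"
    using handshake[OF H] size c fin by (simp add: VH H_def[symmetric] sum.remove)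
  then have "(\<Sum>v\<in>?S. ?d v - 1) = 1"
    using pos cardS n by (subst sum_subtractf_nat) auto
  \<comment> \<open>A sum of naturals equal to 1 has exactly one nonzero term, and that term is
    1.\<close>
  then obtain b where b: "b \<in> ?S" "?d b - 1 = 1"
    and rest: "\<And>v. v \<in> ?S \<Longrightarrow> v \<noteq> b \<Longrightarrow> ?d v - 1 = 0"
    by (metis (no_types, lifting) sum_eq_1_iff finite_Diff[OF fin])
  have deg1: "?d v = 1" if "v \<in> ?S" "v \<noteq> b" for v
    using rest[OF that] pos[OF that(1)] by simp
  have "?d b = 2" using b by simp
  then obtain a d where ad: "nbrs H b = {a, d}" "a \<noteq> d" by (auto simp: card_2_iff)
  have noedge_c: "{c, v} \<notin> edges H" for v using c(2) by (auto simp: nbrs_def)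
  have only_b: "nbrs H x = {b}" "x \<in> ?S" "x \<noteq> b" if "x \<in> {a, d}" for x
  proof -
    have bx: "b \<in> nbrs H x" using that ad nbrs_sym[of x H b] by auto
    then show "x \<in> ?S" "x \<noteq> b"
      using c(2) that ad(1) nbrs_subset[OF H, of b] VH by auto
    then have "?d x = 1" by (rule deg1)
    with bx show "nbrs H x = {b}" by (auto simp: card_1_singleton_iff)
  qed
  have distinct: "a \<in> verts G" "b \<in> verts G" "d \<in> verts G" "a \<noteq> c" "b \<noteq> c" "d \<noteq> c" "a \<noteq> b" "d \<noteq> b"
    using b only_b(2,3) by auto
  let ?T = "verts G - {c, a, b, d}"
  \<comment> \<open>The neighbourhoods of \<open>a\<close>, \<open>b\<close> and \<open>d\<close>
    all stay inside \<open>{a, b, d}\<close>.\<close>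
  have noedge_P: "{u, v} \<notin> edges H" if "u \<in> {a, b, d}" "v \<notin> {a, b, d}" for u v
    using that ad only_b by (auto simp: nbrs_def)
  have noedge_P': "{v, u} \<notin> edges H" if "u \<in> {a, b, d}" "v \<notin> {a, b, d}" for u v
    using noedge_P[OF that] by (simp add: insert_commute)
  have nbrsT: "nbrs (induced H ?T) v = nbrs H v" if v: "v \<in> ?T" for v
  proof -
    have "w \<in> ?T" if "{v, w} \<in> edges H" for w
    proof -
      have "w \<noteq> c" using that noedge_c[of v] by (auto simp: insert_commute)
      moreover have "w \<notin> {a, b, d}" using that noedge_P'[of w v] v by auto
      ultimately show ?thesis using simple_graph_edgeD(2)[OF H that] VH by auto
    qed
    with v show ?thesis by (auto simp: nbrs_def edge_induced)
  qed
  have iso_T: "graph_iso (induced H ?T) (copies (graph_order (induced H ?T) div 2) (complete_graph 2))"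
    by (rule graph_iso_matching) (use deg1 in \<open>auto simp: simple_induced H VH nbrsT\<close>)
  have "card {c, a, b, d} = 4" "{c, a, b, d} \<subseteq> verts G"
    using distinct ad(2) c(1) by (simp_all add: eq_commute)
  then have "graph_order (induced H ?T) = n - 4"
    using fin n by (simp add: graph_order_def card_Diff_subset)
  with iso_T have iso_T': "graph_iso (induced H ?T) (copies ((n - 4) div 2) (complete_graph 2))" by simp
  \<comment> \<open>The target is a nested union, so the gluing lemma is used twice: first for
    \<open>{c}\<close> and \<open>?T\<close> inside \<open>?A\<close>, then for \<open>?A\<close>
    and the path.\<close>
  let ?A = "insert c ?T"
  have "graph_iso (induced H ?A)
      (disjoint_union (complete_graph 1) (copies ((n - 4) div 2) (complete_graph 2)))"
  proof (rule graph_iso_disjoint_union[where A = "{c}" and B = ?T])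
    show "graph_iso (induced (induced H ?A) {c}) (complete_graph 1)"
      using graph_iso_K1[OF H] c(1) by (simp add: induced_induced VH)
    show "graph_iso (induced (induced H ?A) ?T) (copies ((n - 4) div 2) (complete_graph 2))"
      using iso_T' by (simp add: induced_induced subset_insertI)
  qed (auto simp: edge_induced noedge_c)
  moreover have "graph_iso (induced H {a, b, d}) (path_graph 3)"
    using ad only_b[of a] only_b[of d] by (intro graph_iso_P3[OF H]) auto
  ultimately have iso: "graph_iso H (disjoint_union
      (disjoint_union (complete_graph 1) (copies ((n - 4) div 2) (complete_graph 2))) (path_graph 3))"
  proof (rule graph_iso_disjoint_union[where A = ?A and B = "{a, b, d}", rotated 3])
    show "verts H = ?A \<union> {a, b, d}" "?A \<inter> {a, b, d} = {}"
      using distinct c(1) by (auto simp: VH)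
    fix u v assume "u \<in> ?A" "v \<in> {a, b, d}"
    then show "{u, v} \<notin> edges H"
      using distinct by (intro noedge_P') auto
  qed
  from graph_iso_complement[OF iso] show ?thesis
    by (simp add: H_def complement_complement[OF G] extremal_even_def)
qed

theorem theorem9:
  fixes n :: nat
  assumes "n \<ge> 3"
  shows
    "(\<forall>G :: 'a ugraph. almost_peripheral G \<and> graph_order G = n \<longrightarrow> graph_size G \<le> (n - 1)^2 div 2) \<and>
     (\<exists>G :: nat ugraph. almost_peripheral G \<and> graph_order G = n \<and> graph_size G = (n - 1)^2 div 2) \<and>
     (odd n \<longrightarrow>
        almost_peripheral (extremal_odd n) \<and> graph_order (extremal_odd n) = n \<and>
        graph_size (extremal_odd n) = (n - 1)^2 div 2 \<and>
        (\<forall>G :: 'a ugraph. almost_peripheral G \<and> graph_order G = n \<and> graph_size G = (n - 1)^2 div 2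
           \<longrightarrow> graph_iso G (extremal_odd n)) \<and>
        (\<exists>M. perfect_matching (complete_graph (n - 1)) M \<and>
             graph_iso (extremal_odd n)
               (graph_join (complete_graph 1) (delete_edges (complete_graph (n - 1)) M)))) \<and>
     (even n \<longrightarrow>
        almost_peripheral (extremal_even n) \<and> graph_order (extremal_even n) = n \<and>
        graph_size (extremal_even n) = (n - 1)^2 div 2 \<and>
        (\<forall>G :: 'a ugraph. almost_peripheral G \<and> graph_order G = n \<and> graph_size G = (n - 1)^2 div 2
           \<longrightarrow> graph_iso G (extremal_even n)))"
proof (intro conjI impI allI)
  have complement_size: "graph_size G + graph_size (complement G) = n choose 2"
    and center: "n - 1 \<le> 2 * graph_size (complement G)"
    if "almost_peripheral G \<and> graph_order G = n" for G :: "'a ugraph"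
    using that graph_size_complement[of G] almost_peripheral_complement_size[of G] assms
    by (auto simp: almost_peripheral_def connected_graph_def)
  \<comment> \<open>Twice the size of \<open>G\<close> plus twice the size of its complement equals
    this number. Since the complement part is at least \<open>n - 1\<close>, at most
    \<open>(n - 1)^2\<close> remains for \<open>G\<close>.\<close>
  have choose: "2 * (n choose 2) = (n - 1)^2 + (n - 1)"
    using assms by (cases n) (simp_all add: choose_two power2_eq_square)
  show "graph_size G \<le> (n - 1)^2 div 2" if "almost_peripheral G \<and> graph_order G = n" for G :: "'a ugraph"
    using complement_size[OF that] center[OF that] choose by linarith
  show "\<exists>G :: nat ugraph. almost_peripheral G \<and> graph_order G = n \<and> graph_size G = (n - 1)^2 div 2"
    using extremal_odd(5) extremal_even(5) assms by blast
  {
    assume "odd n"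
    note extr = extremal_odd[OF assms \<open>odd n\<close>]
    show "almost_peripheral (extremal_odd n)" "graph_order (extremal_odd n) = n"
      "graph_size (extremal_odd n) = (n - 1)^2 div 2"
      by (fact extr)+
    show "\<exists>M. perfect_matching (complete_graph (n - 1)) M \<and>
      graph_iso (extremal_odd n)
        (graph_join (complete_graph 1) (delete_edges (complete_graph (n - 1)) M))"
      using extremal_odd_join[OF assms \<open>odd n\<close>] .
    fix G :: "'a ugraph"
    assume G: "almost_peripheral G \<and> graph_order G = n \<and> graph_size G = (n - 1)^2 div 2"
    \<comment> \<open>For odd \<open>n\<close> halving is exact, so the complement degree sum takes
      its least possible value \<open>n - 1\<close>.\<close>
    have "even ((n - 1)^2)" using \<open>odd n\<close> by simp
    then have "2 * ((n - 1)^2 div 2) = (n - 1)^2" by simp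
    then have "2 * graph_size (complement G) = n - 1"
      using complement_size[of G] G choose by linarith
    with G assms \<open>odd n\<close> show "graph_iso G (extremal_odd n)" by (intro unique_odd) auto
  next
    assume "even n"
    note extr = extremal_even[OF assms \<open>even n\<close>]
    show "almost_peripheral (extremal_even n)" "graph_order (extremal_even n) = n"
      "graph_size (extremal_even n) = (n - 1)^2 div 2"
      by (fact extr)+
    fix G :: "'a ugraph"
    assume G: "almost_peripheral G \<and> graph_order G = n \<and> graph_size G = (n - 1)^2 div 2"
    \<comment> \<open>For even \<open>n\<close> the floor loses one half, which raises the
      complement degree sum from \<open>n - 1\<close> to \<open>n\<close>.\<close>
    have "odd ((n - 1)^2)" using \<open>even n\<close> assms by simp
    then have "2 * ((n - 1)^2 div 2) + 1 = (n - 1)^2" by (rule odd_two_times_div_two_succ)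
    then have "2 * graph_size (complement G) = n"
      using complement_size[of G] G choose assms by linarith
    with G assms \<open>even n\<close> show "graph_iso G (extremal_even n)" by (intro unique_even) auto
  }
qed

end
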